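(* Assume $\mathcal{FH}_{\hat{\mathbf z}}\neq\emptyset$. There exists a nonempty and compact polyhedron, denoted by $\mathcal{CFH}_{\hat{\mathbf z}}$, such that, for all $k\ge 0$, the optimal solution of $\mathcal M(k)$ belongs to $\mathcal{CFH}_{\hat{\mathbf z}}$. Moreover, the diameter $\mathcal D:=\max_{\mathbf u,\mathbf v\in\mathcal{CFH}_{\hat{\mathbf z}}}\|\mathbf u-\mathbf v\|_2$ of $\mathcal{CFH}_{\hat{\mathbf z}}$ satisfies $$\mathcal D^2\le 2\rho\,(\hat{\mathbf z}^T\hat{\mathbf z})^2 .$$
   Context: $\mathbb{R}^n_+$ is the set of vectors in $\mathbb{R}^n$ with nonnegative entries. $\mathbb Y=\{\mathbf y^1,\dots,\mathbf y^m\}\subset\mathbb{R}^n_+$ is a finite set containing at least one nonzero vector, $\mathbb X:=\mathrm{conv}(\mathbb Y)$, $\mathbb Z:=\mathrm{cone}(\mathbb X)=\{\lambda\mathbf x:\mathbf x\in\mathbb X,\ \lambda\ge 0\}$. A point $\hat{\mathbf z}\in\mathbb{R}^n_+\setminus\{\mathbf 0\}$ is fixed. Define $\mathcal H_{\hat{\mathbf z}}:=\{\mathbf z\in\mathbb{R}^n_+ : \hat{\mathbf z}^T\mathbf z=\hat{\mathbf z}^T\hat{\mathbf z}\}$, $\mathcal{FH}_{\hat{\mathbf z}}:=\{\mathbf z\in\mathcal H_{\hat{\mathbf z}} : \mathbf z\in\mathbb Z\}$ (a closed convex polyhedron, possibly unbounded), and $$\rho:=\max_{\mathbf y\in\mathbb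 Y,\ \mathbf y^T\hat{\mathbf z}\ne 0}\frac{\mathbf y^T\mathbf y}{(\mathbf y^T\hat{\mathbf z})^2}.$$ The Frank-Wolfe (conditional gradient) algorithm is applied to minimizing $\|\mathbf z-\hat{\mathbf z}\|_2^2$ over $\mathcal{FH}_{\hat{\mathbf z}}$: an initial point $\mathbf z^{(0)}\in\mathcal{FH}_{\hat{\mathbf z}}$ is given; at each iteration $k=0,1,2,\dots$, with current point $\mathbf z^{(k)}$, one sets $\nabla f(\mathbf z^{(k)}):=\mathbf z^{(k)}-\hat{\mathbf z}$ and solves the problem $\min_{\mathbf z\in\mathcal{FH}_{\hat{\mathbf z}}}\mathbf z^T\nabla f(\mathbf z^{(k)})$, denoted $\mathcal M(k)$ and formulated as $$\mathcal M(k):\quad \min_{\mathbf y\in\mathbb Y,\ \lambda\ge 0,\ \hat{\mathbf z}^T(\lambda\mathbf y)=\hat{\mathbf z}^T\hat{\mathbf z}} (\lambda\mathbf y)^T\nabla f(\mathbf z^{(k)}),$$ after which the current point is updated to $\mathbf z^{(k+1)}$. *)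

theory Defs
  imports "HOL-Analysis.Analysis"
begin

definition nonneg_orthant :: "(real ^ 'n) set" where
  "nonneg_orthant = {x. \<forall>i. 0 \<le> x $ i}"

definition generated_cone :: "(real ^ 'n) set \<Rightarrow> (real ^ 'n) set" where
  "generated_cone Y = {l *\<^sub>R x | l x. x \<in> convex hull Y \<and> 0 \<le> l}"

definition H :: "real ^ 'n \<Rightarrow> (real ^ 'n) set" where
  "H zhat = {z \<in> nonneg_orthant. zhat \<bullet> z = zhat \<bullet> zhat}"

definition FH :: "(real ^ 'n) set \<Rightarrow> real ^ 'n \<Rightarrow> (real ^ 'n) set" where
  "FH Y zhat = {z \<in> H zhat. z \<in> generated_cone Y}"

definition rho :: "(real ^ 'n) set \<Rightarrow> real ^ 'n \<Rightarrow> real" where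
  "rho Y zhat = Max ((\<lambda>y. (y \<bullet> y) / (y \<bullet> zhat)\<^sup>2) ` {y \<in> Y. y \<bullet> zhat \<noteq> 0})"

(* The gradient of z |-> ||z - zhat||^2, up to the customary factor 2. *)
definition grad :: "real ^ 'n \<Rightarrow> real ^ 'n \<Rightarrow> real ^ 'n" where
  "grad zhat z = z - zhat"

(* M_optimal Y zhat z (y, l): the pair (y, l) is an optimal solution of the subproblem
   at the current point z; the associated point of the space is l *\<^sub>R y. *)
definition M_optimal ::
    "(real ^ 'n) set \<Rightarrow> real ^ 'n \<Rightarrow> real ^ 'n \<Rightarrow> (real ^ 'n) \<times> real \<Rightarrow> bool" where
  "M_optimal Y zhat z =
     is_arg_min (\<lambda>(y, l). (l *\<^sub>R y) \<bullet> grad zhat z)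
                (\<lambda>(y, l). y \<in> Y \<and> 0 \<le> l \<and> zhat \<bullet> (l *\<^sub>R y) = zhat \<bullet> zhat)"

(* frank_wolfe_iterate Y zhat k z: some execution of the algorithm has z as its k-th point.
   Each step moves from the current point towards some optimal solution of the subproblem.
   The step size is an arbitrary number in [0,1], so every step-size rule (exact line
   search, 2/(k+2), ...) and every tie-breaking among optimal solutions is covered. *)
inductive frank_wolfe_iterate ::
    "(real ^ 'n) set \<Rightarrow> real ^ 'n \<Rightarrow> nat \<Rightarrow> real ^ 'n \<Rightarrow> bool"
  for Y :: "(real ^ 'n) set" and zhat :: "real ^ 'n" where
  init: "z \<in> FH Y zhat \<Longrightarrow> frank_wolfe_iterate Y zhat 0 z"
| step: "frank_wolfe_iterate Y zhat k z \<Longrightarrow> M_optimal Y zhat z (y, l) \<Longrightarrow>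
         z' \<in> closed_segment z (l *\<^sub>R y) \<Longrightarrow> frank_wolfe_iterate Y zhat (Suc k) z'"

end

theory Submission
  imports Defs
begin

text \<open>A feasible pair \<open>(y, l)\<close> of the subproblem has \<open>y \<bullet> zhat > 0\<close> and
  \<open>l = (zhat \<bullet> zhat) / (y \<bullet> zhat)\<close>, so only finitely many points \<open>l y\<close> occur, whatever the
  current point is; their convex hull is the required polytope. Its diameter is attained at two
  of these points \<open>u\<close>, \<open>v\<close>, which are nonnegative vectors, whence
  \<open>\<parallel>u - v\<parallel>\<^sup>2 \<le> \<parallel>u\<parallel>\<^sup>2 + \<parallel>v\<parallel>\<^sup>2\<close>, and each summand is at most \<open>\<rho> (zhat \<bullet> zhat)\<^sup>2\<close>.\<close>

text \<open>For \<open>y \<bullet> zhat \<noteq> 0\<close>, this is the point where the line spanned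
  by \<open>y\<close> meets the hyperplane of all \<open>z\<close> with
  \<open>zhat \<bullet> z = zhat \<bullet> zhat\<close>.\<close>

definition scaled :: "real ^ 'n \<Rightarrow> real ^ 'n \<Rightarrow> real ^ 'n" where
  "scaled zhat y = ((zhat \<bullet> zhat) / (y \<bullet> zhat)) *\<^sub>R y"

definition scaled_points :: "(real ^ 'n) set \<Rightarrow> real ^ 'n \<Rightarrow> (real ^ 'n) set" where
  "scaled_points Y zhat = scaled zhat ` {y \<in> Y. y \<bullet> zhat \<noteq> 0}"

lemma finite_scaled_points: "finite Y \<Longrightarrow> finite (scaled_points Y zhat)"
  by (simp add: scaled_points_def)

lemma inner_nonneg_orthant:
  assumes "x \<in> nonneg_orthant" "y \<in> nonneg_orthant"
  shows "0 \<le> x \<bullet> y"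
  using assms by (auto simp: nonneg_orthant_def inner_vec_def intro!: sum_nonneg)

text \<open>The cross term \<open>- 2 * (u \<bullet> v)\<close> is at most 0 for nonnegative
  vectors. This gives the factor 2 in the final bound, where the triangle inequality would only give
  4.\<close>

lemma dist_power2_le_nonneg_orthant:
  assumes "u \<in> nonneg_orthant" "v \<in> nonneg_orthant"
  shows "(dist u v)\<^sup>2 \<le> u \<bullet> u + v \<bullet> v"
  using inner_nonneg_orthant[OF assms]
  by (simp add: dist_norm power2_norm_eq_inner inner_diff_left inner_diff_right inner_commute)

text \<open>The equality constraint reads
  \<open>l * (y \<bullet> zhat) = zhat \<bullet> zhat\<close> with a nonzero right-hand side, so it
  excludes \<open>y \<bullet> zhat = 0\<close> and determines \<open>l\<close>. The sign condition
  is then automatic, as \<open>y \<bullet> zhat\<close> is nonnegative.\<close>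

lemma feasible_iff:
  assumes "Y \<subseteq> nonneg_orthant" "zhat \<in> nonneg_orthant" "zhat \<noteq> 0" "y \<in> Y"
  shows "0 \<le> l \<and> zhat \<bullet> (l *\<^sub>R y) = zhat \<bullet> zhat \<longleftrightarrow>
    y \<bullet> zhat \<noteq> 0 \<and> l = (zhat \<bullet> zhat) / (y \<bullet> zhat)"
proof -
  have "0 \<le> y \<bullet> zhat"
    using assms by (blast intro: inner_nonneg_orthant)
  moreover have "l * (y \<bullet> zhat) = zhat \<bullet> zhat \<longleftrightarrow>
      y \<bullet> zhat \<noteq> 0 \<and> l = (zhat \<bullet> zhat) / (y \<bullet> zhat)"
    using \<open>zhat \<noteq> 0\<close> by (cases "y \<bullet> zhat = 0") (simp_all add: eq_divide_eq)
  ultimately show ?thesis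
    by (auto simp: inner_commute[of zhat y])
qed

text \<open>If all generators were orthogonal to \<open>zhat\<close>, so would be their hull and its
  cone, which then could not meet the hyperplane, since
  \<open>zhat \<bullet> zhat \<noteq> 0\<close>.\<close>

lemma generator_inner_nonzero:
  assumes "zhat \<noteq> 0" "FH Y zhat \<noteq> {}"
  shows "\<exists>y\<in>Y. y \<bullet> zhat \<noteq> 0"
proof (rule ccontr)
  assume "\<not> ?thesis"
  then have "convex hull Y \<subseteq> {x. zhat \<bullet> x = 0}"
    by (intro hull_minimal convex_hyperplane) (auto simp: inner_commute)
  moreover obtain l x where "x \<in> convex hull Y" "zhat \<bullet> (l *\<^sub>R x) = zhat \<bullet> zhat"
    using assms(2) by (auto simp: FH_def H_def generated_cone_def)
  ultimately show False
    using \<open>zhat \<noteq> 0\<close> by auto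
qed

lemma M_optimal_in_scaled_points:
  assumes "Y \<subseteq> nonneg_orthant" "zhat \<in> nonneg_orthant" "zhat \<noteq> 0" "M_optimal Y zhat z (y, l)"
  shows "l *\<^sub>R y \<in> scaled_points Y zhat"
proof -
  have "y \<in> Y" "0 \<le> l \<and> zhat \<bullet> (l *\<^sub>R y) = zhat \<bullet> zhat"
    using assms(4) by (auto simp: M_optimal_def is_arg_min_def)
  then show ?thesis
    using feasible_iff[OF assms(1-3)] by (auto simp: scaled_points_def scaled_def)
qed

text \<open>Ensures that the claim about all optimal solutions is not vacuous: the feasible pairs
  form a finite nonempty set, so the minimum is attained.\<close>

lemma M_optimal_exists:
  assumes "finite Y" "Y \<subseteq> nonneg_orthant" "zhat \<in> nonneg_orthant" "zhat \<noteq> 0"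
    and "\<exists>y\<in>Y. y \<bullet> zhat \<noteq> 0"
  shows "\<exists>y l. M_optimal Y zhat z (y, l)"
proof -
  let ?S = "(\<lambda>y. (y, (zhat \<bullet> zhat) / (y \<bullet> zhat))) ` {y \<in> Y. y \<bullet> zhat \<noteq> 0}"
  have feasible: "(\<lambda>(y, l). y \<in> Y \<and> 0 \<le> l \<and> zhat \<bullet> (l *\<^sub>R y) = zhat \<bullet> zhat) = (\<lambda>p. p \<in> ?S)"
    by (rule ext) (use feasible_iff[OF assms(2-4)] in blast)
  have "finite ?S" "?S \<noteq> {}"
    using assms(1,5) by auto
  then show ?thesis
    using ex_is_arg_min_if_finite[of ?S "\<lambda>(y, l). (l *\<^sub>R y) \<bullet> grad zhat z"]
    unfolding M_optimal_def feasible by (simp only: split_paired_Ex simp_thms)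
qed

lemma scaled_point_nonneg:
  assumes "Y \<subseteq> nonneg_orthant" "zhat \<in> nonneg_orthant" "u \<in> scaled_points Y zhat"
  shows "u \<in> nonneg_orthant"
proof -
  obtain y where "y \<in> Y" "u = ((zhat \<bullet> zhat) / (y \<bullet> zhat)) *\<^sub>R y"
    using assms(3) by (auto simp: scaled_points_def scaled_def)
  moreover have "y \<in> nonneg_orthant" "0 \<le> y \<bullet> zhat"
    using assms \<open>y \<in> Y\<close> inner_nonneg_orthant by auto
  ultimately show ?thesis
    by (simp add: nonneg_orthant_def)
qed

text \<open>The squared norm is \<open>(zhat \<bullet> zhat)\<^sup>2\<close> times one of the ratios
  over which \<open>rho\<close> takes the maximum.\<close>

lemma scaled_point_norm_le:
  assumes "finite Y" "u \<in> scaled_points Y zhat"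
  shows "u \<bullet> u \<le> rho Y zhat * (zhat \<bullet> zhat)\<^sup>2"
proof -
  obtain y where y: "y \<in> Y" "y \<bullet> zhat \<noteq> 0" and u: "u = ((zhat \<bullet> zhat) / (y \<bullet> zhat)) *\<^sub>R y"
    using assms(2) by (auto simp: scaled_points_def scaled_def)
  have "(y \<bullet> y) / (y \<bullet> zhat)\<^sup>2 \<le> rho Y zhat"
    unfolding rho_def using assms(1) y by (intro Max_ge) auto
  from mult_right_mono[OF this, of "(zhat \<bullet> zhat)\<^sup>2"] show ?thesis
    by (simp add: u power2_eq_square mult_ac)
qed

theorem theorem2:
  fixes Y :: "(real ^ 'n) set" and zhat :: "real ^ 'n"
  assumes "finite Y" and "Y \<subseteq> nonneg_orthant" and "\<exists>y\<in>Y. y \<noteq> 0"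
    and "zhat \<in> nonneg_orthant" and "zhat \<noteq> 0"
    and "FH Y zhat \<noteq> {}"
  shows "\<exists>C. polyhedron C \<and> compact C \<and> C \<noteq> {} \<and>
           (\<forall>k z. frank_wolfe_iterate Y zhat k z \<longrightarrow>
              (\<exists>y l. M_optimal Y zhat z (y, l)) \<and>
              (\<forall>y l. M_optimal Y zhat z (y, l) \<longrightarrow> l *\<^sub>R y \<in> C)) \<and>
           (diameter C)\<^sup>2 \<le> 2 * rho Y zhat * (zhat \<bullet> zhat)\<^sup>2"
proof -
  let ?P = "scaled_points Y zhat" and ?B = "2 * rho Y zhat * (zhat \<bullet> zhat)\<^sup>2"
  have fin: "finite ?P"
    using assms(1) by (rule finite_scaled_points)
  have gen: "\<exists>y\<in>Y. y \<bullet> zhat \<noteq> 0"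
    using assms(5,6) by (rule generator_inner_nonzero)
  then have ne: "?P \<noteq> {}"
    by (auto simp: scaled_points_def)
  have dist: "(dist u v)\<^sup>2 \<le> ?B" if "u \<in> ?P" "v \<in> ?P" for u v
  proof -
    have "(dist u v)\<^sup>2 \<le> u \<bullet> u + v \<bullet> v"
      using that scaled_point_nonneg[OF assms(2,4)] by (intro dist_power2_le_nonneg_orthant)
    also have "\<dots> \<le> ?B"
      using that[THEN scaled_point_norm_le[OF assms(1)]] by linarith
    finally show ?thesis .
  qed
  have "norm (u - v) \<le> sqrt ?B" if hull: "u \<in> convex hull ?P" "v \<in> convex hull ?P" for u v
  proof -
    \<comment> \<open>The distance is convex in each argument, so over the hull of a finite set it
      is dominated by the distance of two generating points.\<close>
    obtain p q where "p \<in> ?P" "q \<in> ?P" "norm (u - v) \<le> dist p q"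
      using simplex_extremal_le_exists[OF fin hull] by (auto simp: dist_norm)
    moreover from this(1,2) have "dist p q \<le> sqrt ?B"
      by (intro real_le_rsqrt dist)
    ultimately show ?thesis
      by linarith
  qed
  then have "diameter (convex hull ?P) \<le> sqrt ?B"
    using ne by (intro diameter_le) (auto simp: convex_hull_eq_empty)
  moreover have "0 \<le> diameter (convex hull ?P)"
    using fin by (intro diameter_ge_0 compact_imp_bounded finite_imp_compact_convex_hull)
  \<comment> \<open>Needed for \<open>(sqrt ?B)\<^sup>2 = ?B\<close>; it is the distance bound for a
    point and itself.\<close>
  moreover have "0 \<le> ?B"
  proof -
    obtain u where "u \<in> ?P"
      using ne by blast
    from order_trans[OF zero_le_power2 dist[OF this this]] show ?thesis .
  qed
  ultimately have "(diameter (convex hull ?P))\<^sup>2 \<le> ?B"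
    using power_mono[of "diameter (convex hull ?P)" "sqrt ?B" 2] by simp
  moreover have "polyhedron (convex hull ?P)"
    using fin by (simp add: polytope_convex_hull polytope_imp_polyhedron)
  moreover have "compact (convex hull ?P)"
    using fin by (rule finite_imp_compact_convex_hull)
  moreover have "l *\<^sub>R y \<in> convex hull ?P" if "M_optimal Y zhat z (y, l)" for z y l
    using M_optimal_in_scaled_points[OF assms(2,4,5) that] by (rule hull_inc)
  moreover have "convex hull ?P \<noteq> {}"
    using ne by (simp add: convex_hull_eq_empty)
  moreover note M_optimal_exists[OF assms(1,2,4,5) gen]
  ultimately show ?thesis
    by (intro exI[where x = "convex hull ?P"]) simp
qed

end
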